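(* Let $\alpha>0$ be a constant and let $p=p(n)$ satisfy $p=O(n^{-\alpha})$. Then asymptotically almost surely (i.e. with probability tending to $1$ as $n\to\infty$) the Erdős–Rényi random graph $G(n,p)$ satisfies $$w(G(n,p)) \le \lfloor 1/\alpha + 2 \rfloor .$$
   Context: $G(n,p)$ is the random graph on $n$ labeled vertices in which each of the $\binom n2$ possible edges is present independently with probability $p$. All graphs are simple. A graph homomorphism $\phi:G\to H$ is a map $V(G)\to V(H)$ sending edges to edges; $\mathrm{Hom}(G,H)$ denotes the set of homomorphisms. For $d\ge 0$, $T^d$ is the infinite rooted tree in which the root has $d$ children and every other vertex also has exactly $d$ children (so every non-root vertex has degree $d+1$ and the root has degree $d$). A map $\varphi\in\mathrm{Hom}(T^d,G)$ is called cold if there is a vertex $a$ of $G$ such that for every $k$ there is no $\psi\in\mathrm{Hom}(T^d,G)$ that agrees with $\varphi$ on all vertices at distance $k$ from the root $r$ and has $\psi(r)=a$. A graph $G$ is $d$-warm if $\mathrm{Hom}(T^{d-2},G)$ contains no cold maps, and the warmth $w(G)$ is the largest $d$ for which $G$ is $d$-warm.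
   Formalization: The warmth of a graph without edges is set to 2: such a graph is vacuously d-warm for every d ≥ 2, so no largest d exists, and without a convention the claim is undefined or false, for example for p = 0. *)

theory Defs
  imports "HOL-Probability.Probability" "HOL-Probability.Product_PMF"
    "HOL-Library.Landau_Symbols" "HOL-Library.Extended_Nat"
begin

text \<open>A simple graph is a pair of a vertex set and a set of two-element sets of vertices.\<close>

type_synonym 'a graph = "'a set \<times> 'a set set"

definition verts :: "'a graph \<Rightarrow> 'a set" where
  "verts G = fst G"

definition edges :: "'a graph \<Rightarrow> 'a set set" where
  "edges G = snd G"

text \<open>
  Edges of \<open>H\<close> have two elements, so \<open>\<phi> ` e \<in> edges H\<close> forces \<open>\<phi>\<close> to separate the ends of \<open>e\<close>.
\<close>

definition Hom :: "'a graph \<Rightarrow> 'b graph \<Rightarrow> ('a \<Rightarrow> 'b) set" where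
  "Hom G H = {\<phi> \<in> verts G \<rightarrow>\<^sub>E verts H. \<forall>e\<in>edges G. \<phi> ` e \<in> edges H}"

text \<open>
  The vertices of \<open>T\<^sup>d\<close> are the finite words over \<open>{..<d}\<close>. The root is the empty word,
  the children of \<open>xs\<close> are the words \<open>xs @ [i]\<close>, and the distance of \<open>xs\<close> from the root
  is \<open>length xs\<close>.
\<close>

definition tree :: "nat \<Rightarrow> nat list graph" where
  "tree d = (lists {..<d}, {{xs, xs @ [i]} | xs i. xs \<in> lists {..<d} \<and> i < d})"

definition cold :: "nat \<Rightarrow> 'a graph \<Rightarrow> (nat list \<Rightarrow> 'a) \<Rightarrow> bool" where
  "cold d G \<phi> \<longleftrightarrow> \<phi> \<in> Hom (tree d) G \<and>
     (\<exists>a\<in>verts G. \<forall>k. \<not> (\<exists>\<psi>\<in>Hom (tree d) G.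
        (\<forall>xs\<in>verts (tree d). length xs = k \<longrightarrow> \<psi> xs = \<phi> xs) \<and> \<psi> [] = a))"

definition warm :: "nat \<Rightarrow> 'a graph \<Rightarrow> bool" where
  "warm d G \<longleftrightarrow> 2 \<le> d \<and> \<not> (\<exists>\<phi>\<in>Hom (tree (d - 2)) G. cold (d - 2) G \<phi>)"

text \<open>
  If \<open>G\<close> has no edge, there are no homomorphisms from \<open>T\<^sup>d\<close> to \<open>G\<close> for \<open>d \<ge> 1\<close>, so that
  \<open>G\<close> is vacuously \<open>d\<close>-warm for all \<open>d \<ge> 2\<close> and no largest such \<open>d\<close> exists. The warmth is then
  set to \<open>2\<close>, which is its value on any graph that has both an edge and an isolated vertex.
  (The value \<open>\<infinity>\<close> would make the upper bound on the warmth of random graphs false for \<open>p = 0\<close>.)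
  On all other graphs the supremum is taken in \<open>enat\<close>, so an upper bound on it does assert that
  the set of all \<open>d\<close> for which \<open>G\<close> is \<open>d\<close>-warm is bounded.
\<close>

definition warmth :: "'a graph \<Rightarrow> enat" where
  "warmth G = (if edges G = {} then 2 else (SUP d\<in>{d. warm d G}. enat d))"

lemma warm_edgeless:
  assumes "edges G = {}" "3 \<le> d"
  shows "warm d G"
proof -
  have "{[], [] @ [0]} \<in> edges (tree (d - 2))"
    unfolding tree_def edges_def snd_conv mem_Collect_eq
    using assms(2) by (intro exI[of _ "[]"] exI[of _ 0]) auto
  then have "Hom (tree (d - 2)) G = {}"
    using assms(1) unfolding Hom_def by blast
  then show ?thesis
    using assms(2) by (simp add: warm_def)
qed

definition all_edges :: "'a set \<Rightarrow> 'a set set" where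
  "all_edges V = {e. e \<subseteq> V \<and> card e = 2}"

definition random_graph :: "nat \<Rightarrow> real \<Rightarrow> nat graph pmf" where
  "random_graph n p =
     map_pmf (\<lambda>x. ({..<n}, {e \<in> all_edges {..<n}. x e}))
       (Pi_pmf (all_edges {..<n}) False (\<lambda>_. bernoulli_pmf p))"

end

theory Submission imports Defs begin

text \<open>
  Let \<open>m = \<lfloor>1 / \<alpha>\<rfloor> + 1\<close>, so that \<open>n p\<^sup>m\<close> tends to \<open>0\<close>; it suffices to find cold maps from \<open>T\<^sup>d\<close> for
  all \<open>d \<ge> m\<close>. If \<open>n p \<le> 8 m\<close>, then by the second moment method there is an isolated vertex, and
  any homomorphism that folds the tree onto an edge is cold.

  If \<open>n p \<ge> 8 m\<close>, look at the first \<open>k \<approx> 8 m / p\<close> vertices. They span more than \<open>m k\<close> edges, while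
  the expected number of triples \<open>(v, U, w)\<close>, where \<open>U\<close> consists of \<open>m\<close> common neighbours of \<open>v\<close> and
  \<open>w\<close>, with \<open>v\<close> and \<open>U\<close> among the first \<open>k\<close> vertices but \<open>w\<close> anywhere, is only \<open>O(k n p\<^sup>m) = o(k)\<close>.
  Deleting one edge \<open>{v, u}\<close> with \<open>u \<in> U\<close> for each of them leaves more than \<open>(m - 1) k\<close> edges, hence a
  subgraph \<open>S\<close> of minimum degree at least \<open>m\<close>. Every \<open>v \<in> S\<close> is now the only common neighbour, in the
  whole graph, of some \<open>m\<close> of its neighbours in \<open>S\<close>. A map that sends the children of each tree vertex
  onto such a set of \<open>m\<close> neighbours is determined at the root by its values at any single level.
\<close>

section \<open>Two sources of cold maps\<close>

text \<open>As \<open>d \<ge> 1\<close>, the root has a child, so no homomorphism can send it to the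
  isolated vertex \<open>a\<close>. Every homomorphism is therefore cold with witness
  \<open>a\<close>, and the edge \<open>{u, v}\<close> supplies one: colour the tree by parity of
  depth.\<close>

lemma cold_isolated:
  assumes "{u, v} \<in> edges G" "u \<in> verts G" "v \<in> verts G" "a \<in> verts G"
    and isol: "\<And>e. e \<in> edges G \<Longrightarrow> a \<notin> e" and "d \<ge> 1"
  shows "\<exists>\<phi>. cold d G \<phi>"
proof -
  define \<phi> where "\<phi> = restrict (\<lambda>xs. if even (length xs) then u else v) (lists {..<d})"
  have img: "\<phi> ` {xs, xs @ [i]} = {u, v}" if "xs \<in> lists {..<d}" "i < d" for xs i
    using that unfolding image_insert image_empty by (cases "even (length xs)") (auto simp: \<phi>_def)
  have "\<phi> \<in> Hom (tree d) G"
    unfolding Hom_def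
  proof (intro CollectI conjI ballI)
    show "\<phi> \<in> verts (tree d) \<rightarrow>\<^sub>E verts G"
      using assms by (auto simp: \<phi>_def tree_def verts_def)
    fix e assume "e \<in> edges (tree d)"
    then obtain xs i where xs: "xs \<in> lists {..<d}" "i < d" and e: "e = {xs, xs @ [i]}"
      unfolding tree_def edges_def snd_conv mem_Collect_eq by blast
    show "\<phi> ` e \<in> edges G"
      using assms(1) unfolding e img[OF xs] .
  qed
  moreover have "\<psi> [] \<noteq> a" if "\<psi> \<in> Hom (tree d) G" for \<psi>
  proof
    assume "\<psi> [] = a"
    have "{[], [] @ [0]} \<in> edges (tree d)"
      unfolding tree_def edges_def snd_conv mem_Collect_eq
      using \<open>d \<ge> 1\<close> by (intro exI[of _ "[]"] exI[of _ 0]) auto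
    then have "\<psi> ` {[], [] @ [0]} \<in> edges G"
      using that unfolding Hom_def by blast
    moreover have "a \<in> \<psi> ` {[], [] @ [0]}"
      using \<open>\<psi> [] = a\<close> by auto
    ultimately show False
      using isol by blast
  qed
  ultimately show ?thesis
    using assms(4) unfolding cold_def by blast
qed

text \<open>Build \<open>\<phi>\<close> so that the children of \<open>xs\<close> cover
  \<open>U (\<phi> xs)\<close>. If \<open>\<psi>\<close> agrees with \<open>\<phi>\<close> on one
  level, then on the level above it each \<open>\<psi> xs\<close> is a common neighbour of
  \<open>U (\<phi> xs)\<close>, hence equals \<open>\<phi> xs\<close>; this climbs to the root.
  Uniqueness is required among all vertices of \<open>G\<close> because \<open>\<psi>\<close> may
  leave \<open>S\<close>, while \<open>U v \<subseteq> S\<close> lets the construction continue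
  downwards forever.\<close>

lemma cold_unique_common_neighbours:
  assumes "S \<subseteq> verts G" "s \<in> S" "a \<in> verts G" "a \<noteq> s" and "1 \<le> m" "m \<le> d"
    and U: "\<And>v. v \<in> S \<Longrightarrow> U v \<subseteq> S" "\<And>v. v \<in> S \<Longrightarrow> card (U v) = m"
      "\<And>v u. v \<in> S \<Longrightarrow> u \<in> U v \<Longrightarrow> {v, u} \<in> edges G"
      "\<And>v w. v \<in> S \<Longrightarrow> w \<in> verts G \<Longrightarrow> (\<And>u. u \<in> U v \<Longrightarrow> {w, u} \<in> edges G) \<Longrightarrow> w = v"
  shows "\<exists>\<phi>. cold d G \<phi>"
proof -
  have "\<exists>f. f ` {..<d} = U v" if vS: "v \<in> S" for v
  proof -
    have "finite (U v)" "U v \<noteq> {}"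
      using U(2)[OF vS] \<open>1 \<le> m\<close> by (auto intro: card_ge_0_finite)
    then obtain f where f: "bij_betw f {..<m} (U v)"
      using ex_bij_betw_nat_finite[of "U v"] U(2)[OF vS] by (auto simp: atLeast0LessThan)
    \<comment> \<open>Since \<open>d\<close> may exceed \<open>m\<close>, all surplus children
      repeat the last of the \<open>m\<close> neighbours.\<close>
    have "(\<lambda>i. min i (m - 1)) ` {..<d} = {..<m}"
    proof
      show "{..<m} \<subseteq> (\<lambda>i. min i (m - 1)) ` {..<d}"
      proof
        fix i assume "i \<in> {..<m}"
        then show "i \<in> (\<lambda>i. min i (m - 1)) ` {..<d}"
          using \<open>m \<le> d\<close> by (intro image_eqI[of _ _ i]) auto
      qed
    qed (use \<open>1 \<le> m\<close> in auto)
    then have "(f \<circ> (\<lambda>i. min i (m - 1))) ` {..<d} = U v"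
      using bij_betw_imp_surj_on[OF f] by (simp only: image_comp[symmetric])
    then show ?thesis by blast
  qed
  then obtain c where c: "\<And>v. v \<in> S \<Longrightarrow> c v ` {..<d} = U v"
    by metis
  \<comment> \<open>A word is read as directions for a walk from \<open>s\<close>: the letter
    \<open>i\<close> moves from \<open>v\<close> to \<open>c v i\<close>.\<close>
  define \<phi> where "\<phi> = restrict (foldl c s) (lists {..<d})"
  have root: "\<phi> [] = s"
    by (simp add: \<phi>_def)
  have child: "\<phi> (xs @ [i]) = c (\<phi> xs) i" if "xs \<in> lists {..<d}" "i < d" for xs i
    using that by (simp add: \<phi>_def)
  have in_S: "\<phi> xs \<in> S" if "xs \<in> lists {..<d}" for xs
    using that
  proof (induction xs rule: rev_induct)
    case Nil
    then show ?case using root \<open>s \<in> S\<close> by simp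
  next
    case (snoc i xs)
    then have "c (\<phi> xs) i \<in> U (\<phi> xs)" using c by auto
    then show ?case using snoc child[of xs i] U(1) by auto
  qed
  have hom: "\<phi> \<in> Hom (tree d) G"
    unfolding Hom_def
  proof (intro CollectI conjI ballI)
    show "\<phi> \<in> verts (tree d) \<rightarrow>\<^sub>E verts G"
      using in_S \<open>S \<subseteq> verts G\<close> by (auto simp: \<phi>_def tree_def verts_def)
    fix e assume "e \<in> edges (tree d)"
    then obtain xs i where xs: "xs \<in> lists {..<d}" "i < d" and e: "e = {xs, xs @ [i]}"
      unfolding tree_def edges_def snd_conv mem_Collect_eq by blast
    have "\<phi> ` e = {\<phi> xs, c (\<phi> xs) i}"
      using child[OF xs] e by simp
    then show "\<phi> ` e \<in> edges G"
      using U(3)[OF in_S[OF xs(1)]] c[OF in_S[OF xs(1)]] xs(2) by auto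
  qed
  have root_forced: "\<psi> [] = s"
    if \<psi>: "\<psi> \<in> Hom (tree d) G"
      and agree: "\<forall>xs\<in>verts (tree d). length xs = k \<longrightarrow> \<psi> xs = \<phi> xs" for \<psi> k
  proof -
    \<comment> \<open>Here \<open>j\<close> counts the levels climbed from level \<open>k\<close>;
      \<open>j \<le> k\<close> keeps the subtraction exact, and \<open>j = k\<close> is the
      root.\<close>
    have "\<psi> xs = \<phi> xs" if "xs \<in> lists {..<d}" "length xs = k - j" "j \<le> k" for j xs
      using that
    proof (induction j arbitrary: xs)
      case 0
      then show ?case using agree by (simp add: tree_def verts_def)
    next
      case (Suc j)
      have "{\<psi> xs, u} \<in> edges G" if u: "u \<in> U (\<phi> xs)" for u
      proof -
        obtain i where i: "i < d" "u = c (\<phi> xs) i"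
          using c[OF in_S[OF Suc.prems(1)]] u by auto
        have "\<psi> (xs @ [i]) = \<phi> (xs @ [i])"
          using Suc i by (intro Suc.IH) auto
        moreover have "{xs, xs @ [i]} \<in> edges (tree d)"
          using Suc.prems(1) i(1) unfolding tree_def edges_def by auto
        then have "\<psi> ` {xs, xs @ [i]} \<in> edges G"
          using \<psi> unfolding Hom_def by blast
        ultimately show ?thesis
          using i child[OF Suc.prems(1) i(1)] by simp
      qed
      moreover have "\<psi> xs \<in> verts G"
        using \<psi> Suc.prems(1) by (auto simp: Hom_def tree_def verts_def)
      ultimately show ?case
        using U(4)[OF in_S[OF Suc.prems(1)]] by blast
    qed
    from this[of "[]" k] show ?thesis
      using root by simp
  qed
  have "\<not> (\<exists>\<psi>\<in>Hom (tree d) G. (\<forall>xs\<in>verts (tree d). length xs = k \<longrightarrow> \<psi> xs = \<phi> xs) \<and> \<psi> [] = a)"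
    for k
    using root_forced \<open>a \<noteq> s\<close> by blast
  then show ?thesis
    unfolding cold_def using hom \<open>a \<in> verts G\<close> by (intro exI conjI bexI[of _ a] allI)
qed

section \<open>Subgraphs of large minimum degree\<close>

text \<open>Peeling: removing a vertex of degree at most \<open>m - 1\<close> costs at most
  \<open>m - 1\<close> edges, so the strict inequality survives with one vertex fewer. It fails for
  the empty graph, so the process stops earlier, at a set where all degrees are at least
  \<open>m\<close>.\<close>

lemma exists_min_degree_subgraph:
  assumes "finite W" "F \<subseteq> all_edges W" "(m - 1) * card W < card F" "1 \<le> m"
  shows "\<exists>S\<subseteq>W. S \<noteq> {} \<and> (\<forall>v\<in>S. m \<le> card {u \<in> S. {v, u} \<in> F})"
  using assms
proof (induction "card W" arbitrary: W F)
  case 0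
  then have "W = {}" by simp
  then have "F = {}" using 0 by (auto simp: all_edges_def)
  then show ?case using 0 by simp
next
  case (Suc N)
  show ?case
  proof (cases "\<forall>v\<in>W. m \<le> card {u \<in> W. {v, u} \<in> F}")
    case True
    then show ?thesis using Suc.hyps by (intro exI[of _ W]) auto
  next
    case False
    then obtain v where v: "v \<in> W" "card {u \<in> W. {v, u} \<in> F} \<le> m - 1"
      by force
    define D where "D = {e \<in> F. v \<in> e}"
    have finF: "finite F"
      using Suc.prems by (auto simp: all_edges_def intro: finite_subset[of _ "Pow W"])
    have "D \<subseteq> (\<lambda>u. {v, u}) ` {u \<in> W. {v, u} \<in> F}"
    proof
      fix e assume e: "e \<in> D"
      then have "e \<subseteq> W" "card e = 2" "v \<in> e" "e \<in> F"
        using Suc.prems by (auto simp: D_def all_edges_def)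
      then obtain u where "e = {v, u}"
        by (metis card_2_iff insert_commute insert_iff singletonD)
      then show "e \<in> (\<lambda>u. {v, u}) ` {u \<in> W. {v, u} \<in> F}"
        using \<open>e \<subseteq> W\<close> \<open>e \<in> F\<close> by auto
    qed
    then have "card D \<le> m - 1"
      using surj_card_le[of "{u \<in> W. {v, u} \<in> F}" D] v(2) Suc.prems(1) by force
    moreover have "card (F - D) = card F - card D"
      by (rule card_Diff_subset) (use finF in \<open>auto simp: D_def\<close>)
    moreover have "card (W - {v}) = N"
      using Suc.hyps v(1) Suc.prems(1) by simp
    moreover have "(m - 1) * card W = (m - 1) * N + (m - 1)"
      using Suc.hyps by (metis mult_Suc_right add.commute)
    ultimately have "(m - 1) * card (W - {v}) < card (F - D)"
      using Suc.prems(3) by simp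
    moreover have "F - D \<subseteq> all_edges (W - {v})"
      using Suc.prems(2) by (auto simp: D_def all_edges_def)
    ultimately obtain S where S: "S \<subseteq> W - {v}" "S \<noteq> {}"
      "\<forall>v\<in>S. m \<le> card {u \<in> S. {v, u} \<in> F - D}"
      using Suc.hyps(1)[of "W - {v}" "F - D"] \<open>card (W - {v}) = N\<close> Suc.prems by auto
    have "m \<le> card {u \<in> S. {w, u} \<in> F}" if "w \<in> S" for w
    proof -
      have "finite {u \<in> S. {w, u} \<in> F}"
        using S(1) Suc.prems(1) by (auto intro: finite_subset[of _ W])
      then have "card {u \<in> S. {w, u} \<in> F - D} \<le> card {u \<in> S. {w, u} \<in> F}"
        by (intro card_mono) auto
      then show ?thesis using S(3) that by force
    qed
    then show ?thesis using S by (intro exI[of _ S]) auto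
  qed
qed

section \<open>First and second moment bounds for counting events\<close>

lemma prob_Pi_bernoulli_const:
  assumes "finite A" "E \<subseteq> A" "0 \<le> p" "p \<le> 1"
  shows "measure_pmf.prob (Pi_pmf A dflt (\<lambda>_. bernoulli_pmf p)) {x. \<forall>e\<in>E. x e = b}
    = (if b then p else 1 - p) ^ card E"
proof -
  have "{x. \<forall>e\<in>E. x e = b} = Pi A (\<lambda>e. if e \<in> E then {b} else UNIV)"
    using assms(2) by (auto simp: Pi_def split: if_splits)
  then have "measure_pmf.prob (Pi_pmf A dflt (\<lambda>_. bernoulli_pmf p)) {x. \<forall>e\<in>E. x e = b}
    = (\<Prod>e\<in>A. measure_pmf.prob (bernoulli_pmf p) (if e \<in> E then {b} else UNIV))"
    using assms(1) by (simp add: measure_Pi_pmf_Pi)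
  also have "\<dots> = (\<Prod>e\<in>A. if e \<in> E then (if b then p else 1 - p) else 1)"
    using assms by (intro prod.cong) (auto simp: measure_pmf_single)
  also have "\<dots> = (\<Prod>e\<in>E. (if b then p else 1 - p))"
    using assms by (simp add: prod.If_cases Int_absorb1)
  finally show ?thesis by simp
qed

lemma integrable_pmf_indicator [simp]: "integrable (measure_pmf M) (indicator A :: _ \<Rightarrow> real)"
  by (intro integrable_real_indicator) (simp_all add: measure_pmf.emeasure_eq_measure)

lemma card_eq_sum_indicator:
  assumes "finite I"
  shows "real (card {i \<in> I. x \<in> E i}) = (\<Sum>i\<in>I. indicator (E i) x)"
  using assms by (simp add: indicator_def sum.If_cases Int_def)

text \<open>Markov's inequality for the number of events that occur; the events may depend on each
  other.\<close>

lemma prob_card_ge_le: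
  assumes "finite I" "c > 0"
  shows "measure_pmf.prob M {x. c \<le> real (card {i \<in> I. x \<in> E i})}
    \<le> (\<Sum>i\<in>I. measure_pmf.prob M (E i)) / c"
proof -
  let ?X = "\<lambda>x. \<Sum>i\<in>I. indicator (E i) x :: real"
  have int: "integrable (measure_pmf M) ?X"
    by (intro Bochner_Integration.integrable_sum integrable_pmf_indicator)
  have "measure_pmf.prob M {x \<in> space (measure_pmf M). ?X x \<ge> c} \<le> measure_pmf.expectation M ?X / c"
    using int assms(2)
    by (intro integral_Markov_inequality_measure[where A = "{}"]) (auto intro!: sum_nonneg)
  then show ?thesis
    using assms(1) by (simp add: card_eq_sum_indicator)
qed

text \<open>Chebyshev's inequality. With \<open>N\<close> events, the diagonal contributes at most
  \<open>N * q\<close> to the variance and the excess correlation \<open>\<delta>\<close> at most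
  \<open>N\<^sup>2 * q\<^sup>2 * \<delta>\<close>; a deviation of half the mean \<open>N * q\<close>
  gives the factor 4.\<close>

lemma prob_card_le_half_mean:
  assumes I: "finite I" "I \<noteq> {}" and "q > 0" "\<delta> \<ge> 0"
    and single: "\<And>i. i \<in> I \<Longrightarrow> measure_pmf.prob M (E i) = q"
    and pair: "\<And>i j. i \<in> I \<Longrightarrow> j \<in> I \<Longrightarrow> i \<noteq> j \<Longrightarrow>
      measure_pmf.prob M (E i \<inter> E j) \<le> q\<^sup>2 * (1 + \<delta>)"
  shows "measure_pmf.prob M {x. real (card {i \<in> I. x \<in> E i}) \<le> real (card I) * q / 2}
    \<le> 4 * (1 / (real (card I) * q) + \<delta>)"
proof -
  let ?X = "\<lambda>x. \<Sum>i\<in>I. indicator (E i) x :: real"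
  define N where "N = real (card I)"
  have N: "N > 0" using I by (simp add: N_def card_gt_0_iff)
  have int: "integrable (measure_pmf M) ?X"
    by (intro Bochner_Integration.integrable_sum integrable_pmf_indicator)
  have sq: "(?X x)\<^sup>2 = (\<Sum>i\<in>I. \<Sum>j\<in>I. indicator (E i \<inter> E j) x)" for x
    by (simp add: power2_eq_square sum_product indicator_inter_arith)
  have int2: "integrable (measure_pmf M) (\<lambda>x. (?X x)\<^sup>2)"
    unfolding sq by (intro Bochner_Integration.integrable_sum integrable_pmf_indicator)
  have mean: "measure_pmf.expectation M ?X = N * q"
    using single by (simp add: N_def)
  have "measure_pmf.expectation M (\<lambda>x. (?X x)\<^sup>2)
      = (\<Sum>i\<in>I. \<Sum>j\<in>I. measure_pmf.prob M (E i \<inter> E j))"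
    unfolding sq by simp
  also have "\<dots> \<le> (\<Sum>i\<in>I. \<Sum>j\<in>I. (if j = i then q else 0) + q\<^sup>2 * (1 + \<delta>))"
  proof (intro sum_mono)
    fix i j assume ij: "i \<in> I" "j \<in> I"
    show "measure_pmf.prob M (E i \<inter> E j) \<le> (if j = i then q else 0) + q\<^sup>2 * (1 + \<delta>)"
      using pair[of i j] single[of i] ij \<open>\<delta> \<ge> 0\<close> by auto
  qed
  also have "\<dots> = N * q + N\<^sup>2 * q\<^sup>2 * (1 + \<delta>)"
    using I by (simp add: sum.distrib N_def power2_eq_square algebra_simps)
  finally have "measure_pmf.variance M ?X \<le> N * q + N\<^sup>2 * q\<^sup>2 * \<delta>"
    using measure_pmf.variance_eq[OF int int2] mean by (simp add: power_mult_distrib algebra_simps)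
  then have var: "measure_pmf.variance M ?X / (N * q / 2)\<^sup>2 \<le> 4 * (1 / (N * q) + \<delta>)"
    using N \<open>q > 0\<close> by (simp add: field_simps power2_eq_square)
  have "measure_pmf.prob M {x. ?X x \<le> N * q / 2}
      \<le> measure_pmf.prob M {x \<in> space (measure_pmf M). N * q / 2 \<le> \<bar>?X x - measure_pmf.expectation M ?X\<bar>}"
  proof (intro measure_pmf.finite_measure_mono subsetI)
    fix x assume "x \<in> {x. ?X x \<le> N * q / 2}"
    then show "x \<in> {x \<in> space (measure_pmf M). N * q / 2 \<le> \<bar>?X x - measure_pmf.expectation M ?X\<bar>}"
      unfolding mean by (simp add: abs_if field_simps)
  qed simp
  also have "\<dots> \<le> measure_pmf.variance M ?X / (N * q / 2)\<^sup>2"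
    by (rule measure_pmf.Chebyshev_inequality) (use int2 N \<open>q > 0\<close> in auto)
  finally show ?thesis
    using var I(1) by (simp add: card_eq_sum_indicator N_def)
qed

section \<open>Isolated vertices, edges and common neighbours in the random graph\<close>

lemma all_edges_nat: "finite (all_edges {..<n::nat})" "card (all_edges {..<n}) = n choose 2"
  by (auto simp: all_edges_def n_subsets intro: finite_subset[of _ "Pow {..<n}"])

abbreviation gnp_edges :: "nat \<Rightarrow> real \<Rightarrow> (nat set \<Rightarrow> bool) pmf" where
  "gnp_edges n p \<equiv> Pi_pmf (all_edges {..<n}) False (\<lambda>_. bernoulli_pmf p)"

abbreviation graph_of :: "nat \<Rightarrow> (nat set \<Rightarrow> bool) \<Rightarrow> nat graph" where
  "graph_of n x \<equiv> ({..<n}, {e \<in> all_edges {..<n}. x e})"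

definition star :: "nat \<Rightarrow> nat set \<Rightarrow> nat set set" where
  "star v U = (\<lambda>u. {v, u}) ` U"

lemma card_star: "card (star v U) = card U"
  unfolding star_def by (intro card_image inj_onI) (auto simp: doubleton_eq_iff)

lemma finite_star: "finite U \<Longrightarrow> finite (star v U)"
  by (simp add: star_def)

lemma star_subset: "U \<subseteq> {..<n} \<Longrightarrow> v < n \<Longrightarrow> v \<notin> U \<Longrightarrow> star v U \<subseteq> all_edges {..<n}"
  by (auto simp: star_def all_edges_def card_insert_if)

text \<open>The full stars at \<open>i\<close> and \<open>j\<close> share only the edge
  \<open>{i, j}\<close>, so both vertices are isolated with probability
  \<open>q\<^sup>2 / (1 - p)\<close>, where \<open>q = (1 - p) ^ (n - 1)\<close>. For
  \<open>p \<le> 1 / 2\<close> this is at most \<open>q\<^sup>2 * (1 + 2 * p)\<close>, the second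
  moment bound with \<open>\<delta> = 2 * p\<close>.\<close>

lemma prob_few_isolated:
  assumes "0 \<le> p" "p \<le> 1 / 2" "n \<ge> 1"
  defines "I \<equiv> \<lambda>x. {i \<in> {..<n}. \<forall>e\<in>star i ({..<n} - {i}). x e = False}"
  shows "measure_pmf.prob (gnp_edges n p) {x. real (card (I x)) \<le> real n * (1 - p) ^ (n - 1) / 2}
    \<le> 4 * (1 / (real n * (1 - p) ^ (n - 1)) + 2 * p)"
proof -
  let ?E = "\<lambda>i. {x. \<forall>e\<in>star i ({..<n} - {i}). x e = False}"
  have single: "measure_pmf.prob (gnp_edges n p) (?E i) = (1 - p) ^ (n - 1)" if "i \<in> {..<n}" for i
    using that assms(1,2) star_subset[of "{..<n} - {i}" n i]
    by (subst prob_Pi_bernoulli_const) (auto simp: all_edges_nat card_star)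
  have pair: "measure_pmf.prob (gnp_edges n p) (?E i \<inter> ?E j) \<le> ((1 - p) ^ (n - 1))\<^sup>2 * (1 + 2 * p)"
    if "i \<in> {..<n}" "j \<in> {..<n}" "i \<noteq> j" for i j
  proof -
    let ?A = "star i ({..<n} - {i})" and ?B = "star j ({..<n} - {j})"
    have "?A \<inter> ?B = {{i, j}}"
      using that by (auto simp: star_def doubleton_eq_iff)
    then have c: "card (?A \<union> ?B) + 1 = 2 * (n - 1)"
      using that card_Un_Int[of ?A ?B] by (simp add: finite_star card_star)
    have "?E i \<inter> ?E j = {x. \<forall>e\<in>?A \<union> ?B. x e = False}"
      by auto
    then have "measure_pmf.prob (gnp_edges n p) (?E i \<inter> ?E j) = (1 - p) ^ card (?A \<union> ?B)"
      using that assms(1,2) star_subset[of "{..<n} - {i}" n i] star_subset[of "{..<n} - {j}" n j]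
      by (simp only:) (subst prob_Pi_bernoulli_const, auto simp: all_edges_nat)
    \<comment> \<open>The missing factor \<open>1 - p\<close> is supplied at the price of
      \<open>1 + 2 * p\<close>; the product of the two is
      \<open>1 + p - 2 * p\<^sup>2 \<ge> 1\<close>.\<close>
    also have "\<dots> \<le> (1 - p) ^ card (?A \<union> ?B) * ((1 - p) * (1 + 2 * p))"
    proof -
      have "1 \<le> (1 - p) * (1 + 2 * p)"
        using assms(1,2) mult_left_mono[of p "1/2" p] by (auto simp: algebra_simps)
      then show ?thesis
        using mult_left_mono[of 1 "(1 - p) * (1 + 2 * p)" "(1 - p) ^ card (?A \<union> ?B)"] assms(1,2)
        by simp
    qed
    also have "\<dots> = (1 - p) ^ (card (?A \<union> ?B) + 1) * (1 + 2 * p)"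
      by simp
    also have "\<dots> = ((1 - p) ^ (n - 1))\<^sup>2 * (1 + 2 * p)"
      unfolding c by (simp add: power_mult[symmetric] mult.commute)
    finally show ?thesis .
  qed
  have "measure_pmf.prob (gnp_edges n p)
      {x. real (card {i \<in> {..<n}. x \<in> ?E i}) \<le> real (card {..<n}) * (1 - p) ^ (n - 1) / 2}
    \<le> 4 * (1 / (real (card {..<n}) * (1 - p) ^ (n - 1)) + 2 * p)"
    using assms(1-3) single pair by (intro prob_card_le_half_mean) (auto simp: lessThan_empty_iff)
  then show ?thesis by (simp add: I_def)
qed

text \<open>Distinct edges are independent, so the second moment bound applies with
  \<open>\<delta> = 0\<close>.\<close>

lemma prob_few_edges:
  assumes "0 < p" "p \<le> 1" "2 \<le> k" "k \<le> n"
  shows "measure_pmf.prob (gnp_edges n p)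
      {x. real (card {e \<in> all_edges {..<k}. x e}) \<le> real (k choose 2) * p / 2}
    \<le> 4 / (real (k choose 2) * p)"
proof -
  have sub: "all_edges {..<k} \<subseteq> all_edges {..<n}"
    using assms(4) by (auto simp: all_edges_def)
  have single: "measure_pmf.prob (gnp_edges n p) {x. x e} = p" if "e \<in> all_edges {..<k}" for e
    using prob_Pi_bernoulli_const[of "all_edges {..<n}" "{e}" p False True] that sub assms
    by (auto simp: all_edges_nat)
  have pair: "measure_pmf.prob (gnp_edges n p) ({x. x e} \<inter> {x. x f}) \<le> p\<^sup>2 * (1 + 0)"
    if "e \<in> all_edges {..<k}" "f \<in> all_edges {..<k}" "e \<noteq> f" for e f
  proof -
    have "{x. x e} \<inter> {x. x f} = {x. \<forall>g\<in>{e, f}. x g = True}"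
      by auto
    moreover have "{e, f} \<subseteq> all_edges {..<n}" "card {e, f} = 2"
      using that sub by auto
    ultimately show ?thesis
      using prob_Pi_bernoulli_const[of "all_edges {..<n}" "{e, f}" p False True] assms(1,2)
      by (simp only: all_edges_nat) simp
  qed
  have "real (k choose 2) > 0"
    using assms(3) by (simp add: zero_less_binomial)
  then have "all_edges {..<k} \<noteq> {}"
    using all_edges_nat(2)[of k] by auto
  then show ?thesis
    using prob_card_le_half_mean[of "all_edges {..<k}" p 0 "gnp_edges n p" "\<lambda>e. {x. x e}"]
      single pair assms by (simp add: all_edges_nat)
qed

text \<open>The potential obstructions to \<open>v\<close> being the only common neighbour of
  \<open>U\<close>. The competitor \<open>w\<close> ranges over the whole graph, and the inequations
  make the \<open>2 * m\<close> edges required by a triple distinct and free of loops.\<close>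

definition common_nbr_triples :: "nat \<Rightarrow> nat \<Rightarrow> nat \<Rightarrow> (nat \<times> nat set \<times> nat) set" where
  "common_nbr_triples m n k =
    {(v, U, w). v < k \<and> U \<subseteq> {..<k} \<and> card U = m \<and> v \<notin> U \<and> w < n \<and> w \<noteq> v \<and> w \<notin> U}"

definition triple_edges :: "nat \<times> nat set \<times> nat \<Rightarrow> nat set set" where
  "triple_edges = (\<lambda>(v, U, w). star v U \<union> star w U)"

lemma common_nbr_triples_card:
  "finite (common_nbr_triples m n k)" "card (common_nbr_triples m n k) \<le> k * k ^ m * n"
proof -
  let ?Q = "{..<k} \<times> {U. U \<subseteq> {..<k} \<and> card U = m} \<times> {..<n}"
  have sub: "common_nbr_triples m n k \<subseteq> ?Q"
    by (auto simp: common_nbr_triples_def)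
  have fin: "finite ?Q"
    by (auto intro: finite_subset[of _ "Pow {..<k}"])
  then show "finite (common_nbr_triples m n k)"
    using sub finite_subset by blast
  have "card (common_nbr_triples m n k) \<le> card ?Q"
    using sub fin by (rule card_mono[rotated])
  also have "\<dots> = k * (k choose m) * n"
    by (simp add: card_cartesian_product n_subsets)
  also have "\<dots> \<le> k * k ^ m * n"
    by (cases "m \<le> k") (auto intro: binomial_le_pow simp: binomial_eq_0)
  finally show "card (common_nbr_triples m n k) \<le> k * k ^ m * n" .
qed

text \<open>There are at most \<open>k * k ^ m * n\<close> triples, each realised with probability
  \<open>p ^ (2 * m)\<close>. Markov's inequality at the threshold \<open>k\<close> cancels the
  factor coming from the choice of \<open>v\<close>.\<close>

lemma prob_many_common_nbr_triples:
  assumes "0 \<le> p" "p \<le> 1" "1 \<le> k" "k \<le> n"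
  shows "measure_pmf.prob (gnp_edges n p)
      {x. real k \<le> real (card {t \<in> common_nbr_triples m n k. \<forall>e\<in>triple_edges t. x e})}
    \<le> real n * real k ^ m * p ^ (2 * m)"
proof -
  let ?T = "common_nbr_triples m n k"
  have single: "measure_pmf.prob (gnp_edges n p) {x. \<forall>e\<in>triple_edges t. x e} = p ^ (2 * m)"
    if "t \<in> ?T" for t
  proof -
    obtain v U w where t: "t = (v, U, w)" by (cases t) auto
    have *: "v < n" "U \<subseteq> {..<n}" "card U = m" "v \<notin> U" "w < n" "w \<noteq> v" "w \<notin> U"
      using that assms(4) by (auto simp: t common_nbr_triples_def)
    then have "finite U" using finite_subset by blast
    moreover have "star v U \<inter> star w U = {}"
      using * by (auto simp: star_def doubleton_eq_iff)
    ultimately have "card (triple_edges t) = 2 * m"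
      using * by (simp add: t triple_edges_def card_Un_disjoint finite_star card_star)
    moreover have "triple_edges t \<subseteq> all_edges {..<n}"
      using * star_subset by (auto simp: t triple_edges_def)
    ultimately show ?thesis
      using prob_Pi_bernoulli_const[of "all_edges {..<n}" "triple_edges t" p False True] assms(1,2)
      by (simp add: all_edges_nat)
  qed
  have "measure_pmf.prob (gnp_edges n p)
      {x. real k \<le> real (card {t \<in> ?T. \<forall>e\<in>triple_edges t. x e})}
    \<le> (\<Sum>t\<in>?T. measure_pmf.prob (gnp_edges n p) {x. \<forall>e\<in>triple_edges t. x e}) / real k"
    using prob_card_ge_le[of ?T "real k" "gnp_edges n p" "\<lambda>t. {x. \<forall>e\<in>triple_edges t. x e}"]
      common_nbr_triples_card(1) assms(3) by simp
  also have "\<dots> = real (card ?T) * p ^ (2 * m) / real k"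
    using single by simp
  also have "\<dots> \<le> real (k * k ^ m * n) * p ^ (2 * m) / real k"
    using common_nbr_triples_card(2) assms(1)
    by (intro divide_right_mono mult_right_mono) (auto simp flip: of_nat_mult of_nat_power)
  also have "\<dots> = real n * real k ^ m * p ^ (2 * m)"
    using assms(3) by simp
  finally show ?thesis .
qed

section \<open>From few common neighbours to a cold map\<close>

text \<open>Deleting one edge per realised triple leaves more than \<open>(m - 1) * k\<close> edges,
  and peeling yields \<open>S\<close>. A second common neighbour \<open>w\<close> of
  \<open>U v\<close> would make \<open>(v, U v, w)\<close> a realised triple, so one of the edges
  from \<open>v\<close> to \<open>U v\<close> would have been deleted, although all of them survive
  in \<open>F\<close>.\<close>

lemma cold_if_few_common_nbr_triples:
  assumes "1 \<le> m" "m \<le> d" "k \<le> n"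
    and many: "m * k < card {e \<in> all_edges {..<k}. x e}"
    and few: "card {t \<in> common_nbr_triples m n k. \<forall>e\<in>triple_edges t. x e} \<le> k"
  shows "\<exists>\<phi>. cold d (graph_of n x) \<phi>"
proof -
  define B where "B = {t \<in> common_nbr_triples m n k. \<forall>e\<in>triple_edges t. x e}"
  \<comment> \<open>The deleted edge depends on \<open>v\<close> and \<open>U\<close> only. It does
    join \<open>v\<close> to \<open>U\<close>, which is nonempty because
    \<open>m \<ge> 1\<close>.\<close>
  define D where "D = (\<lambda>(v, U, w). {v, SOME u. u \<in> U}) ` B"
  define F where "F = {e \<in> all_edges {..<k}. x e} - D"
  have "finite B" "card B \<le> k"
    using few common_nbr_triples_card(1) by (auto simp: B_def)
  then have "card D \<le> k" "finite D"
    using card_image_le[of B] unfolding D_def by (auto intro: le_trans)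
  then have "card {e \<in> all_edges {..<k}. x e} - k \<le> card F"
    using diff_card_le_card_Diff[of D "{e \<in> all_edges {..<k}. x e}"] unfolding F_def by linarith
  moreover have "m * k = (m - 1) * k + k"
    using \<open>1 \<le> m\<close> by (cases m) auto
  ultimately have "(m - 1) * card {..<k} < card F"
    using many by simp
  moreover have "F \<subseteq> all_edges {..<k}"
    by (auto simp: F_def)
  ultimately obtain S where S: "S \<subseteq> {..<k}" "S \<noteq> {}"
    and deg: "\<forall>v\<in>S. m \<le> card {u \<in> S. {v, u} \<in> F}"
    using exists_min_degree_subgraph[of "{..<k}" F m] \<open>1 \<le> m\<close> by auto
  have "\<exists>U \<subseteq> {u \<in> S. {v, u} \<in> F}. card U = m" if "v \<in> S" for v
    using obtain_subset_with_card_n[of m "{u \<in> S. {v, u} \<in> F}"] deg that by blast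
  then obtain U where U: "\<And>v. v \<in> S \<Longrightarrow> U v \<subseteq> {u \<in> S. {v, u} \<in> F}" "\<And>v. v \<in> S \<Longrightarrow> card (U v) = m"
    by metis
  have no_loop: "{v} \<notin> all_edges V" for v :: nat and V
    by (simp add: all_edges_def)
  have FG: "F \<subseteq> edges (graph_of n x)"
    using \<open>k \<le> n\<close> by (auto simp: F_def edges_def all_edges_def)
  obtain s where "s \<in> S" using S by auto
  have ne: "U s \<noteq> {}"
    using U(2)[OF \<open>s \<in> S\<close>] \<open>1 \<le> m\<close> by auto
  \<comment> \<open>Coldness needs some vertex other than the root value \<open>s\<close>; a
    neighbour of \<open>s\<close> will do.\<close>
  then obtain a where a: "a \<in> U s" by auto
  then have "a \<in> S" "{s, a} \<in> F"
    using U(1)[OF \<open>s \<in> S\<close>] by auto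
  then have "a \<noteq> s"
    using no_loop by (auto simp: F_def)
  show ?thesis
  proof (rule cold_unique_common_neighbours[of S _ s a m d U])
    show "S \<subseteq> verts (graph_of n x)"
      using S \<open>k \<le> n\<close> by (auto simp: verts_def)
    then show "a \<in> verts (graph_of n x)"
      using \<open>a \<in> S\<close> by blast
    show "{v, u} \<in> edges (graph_of n x)" if "v \<in> S" "u \<in> U v" for v u
      using U(1)[OF that(1)] that(2) FG by auto
    show "w = v" if "v \<in> S" and w: "w \<in> verts (graph_of n x)"
      and adj: "\<And>u. u \<in> U v \<Longrightarrow> {w, u} \<in> edges (graph_of n x)" for v w
    proof (rule ccontr)
      assume "w \<noteq> v"
      have "w \<notin> U v"
        using adj[of w] no_loop by (auto simp: edges_def)
      moreover have "v \<notin> U v"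
        using U(1)[OF \<open>v \<in> S\<close>] no_loop by (auto simp: F_def)
      moreover have "U v \<subseteq> {..<k}" "v < k"
        using U(1)[OF \<open>v \<in> S\<close>] S \<open>v \<in> S\<close> by auto
      ultimately have "(v, U v, w) \<in> common_nbr_triples m n k"
        using \<open>w \<noteq> v\<close> w U(2)[OF \<open>v \<in> S\<close>] by (auto simp: common_nbr_triples_def verts_def)
      moreover have "\<forall>e\<in>triple_edges (v, U v, w). x e"
        using U(1)[OF \<open>v \<in> S\<close>] adj by (auto simp: triple_edges_def star_def F_def edges_def)
      ultimately have "(v, U v, w) \<in> B"
        by (simp add: B_def)
      then have "{v, SOME u. u \<in> U v} \<in> D"
        unfolding D_def by force
      moreover have "U v \<noteq> {}"
        using U(2)[OF \<open>v \<in> S\<close>] \<open>1 \<le> m\<close> by auto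
      then have "(SOME u. u \<in> U v) \<in> U v"
        by (rule some_in_eq[THEN iffD2])
      then have "{v, SOME u. u \<in> U v} \<in> F"
        using U(1)[OF \<open>v \<in> S\<close>] by blast
      ultimately show False
        by (simp add: F_def)
    qed
  qed (use \<open>s \<in> S\<close> \<open>a \<noteq> s\<close> assms(1,2) U in auto)
qed

section \<open>Warmth in the sparse and the dense range\<close>

text \<open>Being \<open>d\<close>-warm concerns the tree of branching \<open>d - 2\<close>, so
  \<open>d > m + 1\<close> means branching at least \<open>m\<close>. An edgeless graph has no cold
  maps from these trees, but its warmth is 2 by convention, and
  \<open>2 \<le> m + 1\<close>.\<close>

lemma warmth_le_if_cold:
  assumes "\<And>d. edges G \<noteq> {} \<Longrightarrow> m \<le> d \<Longrightarrow> \<exists>\<phi>. cold d G \<phi>" "1 \<le> m"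
  shows "warmth G \<le> enat (m + 1)"
proof (cases "edges G = {}")
  case True
  have "(2::enat) = enat 2" by (simp add: numeral_eq_enat)
  then show ?thesis using True \<open>1 \<le> m\<close> by (simp add: warmth_def)
next
  case False
  have "d \<le> m + 1" if "warm d G" for d
  proof (rule ccontr)
    assume "\<not> d \<le> m + 1"
    then have "m \<le> d - 2" by simp
    then obtain \<phi> where "cold (d - 2) G \<phi>"
      using assms(1)[OF False] by blast
    then show False
      using that unfolding warm_def by (meson cold_def)
  qed
  then show ?thesis
    using False by (auto simp: warmth_def intro!: SUP_least)
qed

lemma prob_random_graph_ge:
  assumes "\<And>x. x \<notin> Bad \<Longrightarrow> P (graph_of n x)" "measure_pmf.prob (gnp_edges n p) Bad \<le> b"
  shows "1 - b \<le> measure_pmf.prob (random_graph n p) {G. P G}"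
proof -
  have "1 - b \<le> 1 - measure_pmf.prob (gnp_edges n p) Bad"
    using assms(2) by simp
  also have "\<dots> = measure_pmf.prob (gnp_edges n p) (- Bad)"
    using measure_pmf.prob_compl[of Bad "gnp_edges n p"] by (simp add: Compl_eq_Diff_UNIV)
  also have "\<dots> \<le> measure_pmf.prob (gnp_edges n p) (graph_of n -` {G. P G})"
    using assms(1) by (intro measure_pmf.finite_measure_mono) auto
  finally show ?thesis
    by (simp add: random_graph_def)
qed

text \<open>For \<open>p \<le> 1 / 2\<close>, \<open>ln (1 - p) \<ge> - 2 * p\<close>, so a vertex
  is isolated with probability at least \<open>exp (- 2 * B)\<close>. The mean number of isolated
  vertices is then of order \<open>n\<close>, and the second moment bound provides one.\<close>

lemma warmth_sparse_random_graph:
  assumes "0 \<le> p" "p \<le> 1 / 2" "n \<ge> 1" "real n * p \<le> B" "1 \<le> m"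
  shows "1 - 4 * (exp (2 * B) / real n + 2 * p)
    \<le> measure_pmf.prob (random_graph n p) {G. warmth G \<le> enat (m + 1)}"
proof -
  define I where "I = (\<lambda>x. {i \<in> {..<n}. \<forall>e\<in>star i ({..<n} - {i}). x e = False})"
  define q where "q = (1 - p) ^ (n - 1)"
  have "real n * (- 2 * p) \<le> real n * ln (1 - p)"
  proof (rule mult_left_mono)
    have "2 * p\<^sup>2 \<le> p"
      using assms(1,2) mult_left_mono[of p "1/2" p] by (simp add: power2_eq_square)
    then show "- 2 * p \<le> ln (1 - p)"
      using ln_one_minus_pos_lower_bound[of p] assms(1,2) by linarith
  qed simp
  then have "exp (- 2 * B) \<le> exp (real n * ln (1 - p))"
    using assms(4) by (simp add: mult.assoc[symmetric])
  also have "\<dots> = (1 - p) ^ n"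
    using assms(2) by (simp add: exp_of_nat_mult)
  also have "\<dots> \<le> q"
    unfolding q_def using assms(1,2) by (intro power_decreasing) auto
  finally have q: "exp (- 2 * B) \<le> q" .
  then have "q > 0" by (rule less_le_trans[rotated]) simp
  have "inverse q \<le> inverse (exp (- 2 * B))"
    using q by (intro le_imp_inverse_le) auto
  then have "inverse q \<le> exp (2 * B)"
    by (simp add: exp_minus[symmetric])
  then have "inverse q / real n \<le> exp (2 * B) / real n"
    by (intro divide_right_mono) auto
  then have "1 / (real n * q) \<le> exp (2 * B) / real n"
    by (simp add: field_simps)
  then have bound: "measure_pmf.prob (gnp_edges n p) {x. real (card (I x)) \<le> real n * q / 2}
      \<le> 4 * (exp (2 * B) / real n + 2 * p)"
    using prob_few_isolated[OF assms(1-3)] by (simp add: I_def q_def)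
  show ?thesis
  proof (rule prob_random_graph_ge[OF _ bound])
    \<comment> \<open>Only the existence of an isolated vertex \<open>i\<close> is extracted from
      the count.\<close>
    fix x assume "x \<notin> {x. real (card (I x)) \<le> real n * q / 2}"
    moreover have "real n * q / 2 \<ge> 0"
      using \<open>q > 0\<close> by simp
    ultimately have "card (I x) \<noteq> 0"
      by (auto simp: not_le)
    then obtain i where i: "i < n" "\<forall>e\<in>star i ({..<n} - {i}). x e = False"
      by (auto simp: I_def card_eq_0_iff)
    show "warmth (graph_of n x) \<le> enat (m + 1)"
    proof (rule warmth_le_if_cold[OF _ \<open>1 \<le> m\<close>])
      fix d assume "edges (graph_of n x) \<noteq> {}" "m \<le> d"
      then obtain e where e: "e \<in> edges (graph_of n x)" by blast
      then have "card e = 2" "e \<subseteq> {..<n}" by (auto simp: edges_def all_edges_def)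
      then obtain u v where uv: "e = {u, v}" "u < n" "v < n"
        by (auto simp: card_2_iff)
      have isol: "i \<notin> e'" if "e' \<in> edges (graph_of n x)" for e'
      proof
        assume "i \<in> e'"
        have "card e' = 2" "e' \<subseteq> {..<n}" "x e'"
          using that by (auto simp: edges_def all_edges_def)
        then obtain w where "e' = {i, w}" "w \<noteq> i"
          using \<open>i \<in> e'\<close> by (auto simp: card_2_iff)
        then show False
          using i(2) \<open>x e'\<close> \<open>e' \<subseteq> {..<n}\<close> by (auto simp: star_def)
      qed
      show "\<exists>\<phi>. cold d (graph_of n x) \<phi>"
        by (rule cold_isolated[of u v _ i])
          (use e uv i(1) isol \<open>1 \<le> m\<close> \<open>m \<le> d\<close> in \<open>auto simp: verts_def\<close>)
    qed
  qed
qed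

text \<open>The choice of \<open>k\<close> gives \<open>8 * m \<le> k * p \<le> 9 * m\<close>. The
  lower bound makes half the expected number of edges on \<open>k\<close> vertices at least
  \<open>m * k\<close>; the upper bound controls the triples, since
  \<open>n * k ^ m * p ^ (2 * m) = (k * p) ^ m * (n * p ^ m)\<close>.\<close>

lemma warmth_dense_random_graph:
  assumes "0 < p" "p \<le> 1" "8 * real m \<le> real n * p" "1 \<le> m"
  shows "1 - (p + (9 * real m) ^ m * (real n * p ^ m))
    \<le> measure_pmf.prob (random_graph n p) {G. warmth G \<le> enat (m + 1)}"
proof -
  define k where "k = nat \<lceil>8 * real m / p\<rceil>"
  have m1: "1 \<le> real m" using \<open>1 \<le> m\<close> by simp
  have "8 * real m / p \<le> real k"
    unfolding k_def by (rule real_nat_ceiling_ge)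
  then have kp: "8 * real m \<le> real k * p"
    using assms(1) by (simp add: field_simps)
  then have "8 \<le> real k * p" using m1 by linarith
  also have "\<dots> \<le> real k * 1" using assms(2) by (intro mult_left_mono) auto
  finally have k8: "8 \<le> real k" by simp
  have "8 * real m / p \<le> real n"
    using assms(1,3) by (simp add: field_simps)
  \<comment> \<open>This is where the density assumption \<open>8 * m \<le> n * p\<close>
    enters.\<close>
  then have "k \<le> n"
    unfolding k_def by (simp add: nat_le_iff ceiling_le_iff)
  have "real k \<le> 8 * real m / p + 1"
    unfolding k_def using assms(1) by (simp add: of_nat_ceiling le_of_int_ceiling)
  then have "real k * p \<le> (8 * real m / p + 1) * p"
    using assms(1) by (intro mult_right_mono) auto
  also have "\<dots> = 8 * real m + p"
    using assms(1) by (simp add: distrib_right)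
  finally have kp_le: "real k * p \<le> 9 * real m"
    using assms(2) m1 by linarith
  have ch: "real (k choose 2) * p = real (k - 1) * (real k * p) / 2"
  proof -
    have "2 dvd k * (k - 1)" by (cases "even k") auto
    then have "real (k choose 2) = real (k * (k - 1)) / real 2"
      unfolding choose_two by (rule real_of_nat_div)
    then show ?thesis by (simp add: mult_ac)
  qed
  have k1: "real (k - 1) = real k - 1" using k8 by (simp add: of_nat_diff)
  have "(real k - 1) * (8 * real m) \<le> (real k - 1) * (real k * p)"
    using k8 kp by (intro mult_left_mono) auto
  then have chge: "4 * real m * (real k - 1) \<le> real (k choose 2) * p"
    unfolding ch k1 by (simp add: algebra_simps)
  \<comment> \<open>Half the mean is at least \<open>2 * m * (k - 1)\<close>, which is at least
    \<open>m * k\<close> once \<open>k \<ge> 2\<close>.\<close>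
  have "real m * real k \<le> 2 * real m * (real k - 1)"
    using k8 m1 mult_left_mono[of 2 "real k" "real m"] by (simp add: algebra_simps)
  then have mk: "real (m * k) \<le> real (k choose 2) * p / 2"
    using chge by simp
  \<comment> \<open>Together with a mean of at least \<open>4 * (k - 1)\<close>, this bounds the
    Chebyshev error by \<open>p\<close>.\<close>
  have "(real k - 1) * p \<ge> 1"
    using kp m1 assms(2) by (simp add: algebra_simps)
  moreover have "4 * 1 * (real k - 1) \<le> 4 * real m * (real k - 1)"
    using k8 m1 by (intro mult_right_mono mult_left_mono) auto
  then have ck: "4 * (real k - 1) \<le> real (k choose 2) * p"
    using chge by linarith
  then have "p * (4 * (real k - 1)) \<le> p * (real (k choose 2) * p)"
    using assms(1) by (intro mult_left_mono) auto
  ultimately have "4 \<le> p * (real (k choose 2) * p)"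
    by (simp add: algebra_simps)
  moreover have pos: "real (k choose 2) * p > 0"
    by (rule less_le_trans[OF _ ck]) (use k8 in simp)
  ultimately have err1: "4 / (real (k choose 2) * p) \<le> p"
    by (simp add: pos_divide_le_eq)
  have "real n * real k ^ m * p ^ (2 * m) = (real k * p) ^ m * (real n * p ^ m)"
    by (simp add: power_mult_distrib mult_2 power_add)
  also have "\<dots> \<le> (9 * real m) ^ m * (real n * p ^ m)"
    using kp_le assms(1) by (intro mult_right_mono power_mono) auto
  finally have err2: "real n * real k ^ m * p ^ (2 * m) \<le> (9 * real m) ^ m * (real n * p ^ m)" .
  let ?Few = "{x. real (card {e \<in> all_edges {..<k}. x e}) \<le> real (k choose 2) * p / 2}"
  let ?Many = "{x. real k \<le> real (card {t \<in> common_nbr_triples m n k. \<forall>e\<in>triple_edges t. x e})}"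
  have "measure_pmf.prob (gnp_edges n p) (?Few \<union> ?Many)
      \<le> measure_pmf.prob (gnp_edges n p) ?Few + measure_pmf.prob (gnp_edges n p) ?Many"
    by (rule measure_Un_le) auto
  also have "\<dots> \<le> p + (9 * real m) ^ m * (real n * p ^ m)"
  proof (rule add_mono)
    show "measure_pmf.prob (gnp_edges n p) ?Few \<le> p"
      using prob_few_edges[of p k n] err1 assms(1,2) k8 \<open>k \<le> n\<close> by simp
    show "measure_pmf.prob (gnp_edges n p) ?Many \<le> (9 * real m) ^ m * (real n * p ^ m)"
      by (rule order_trans[OF prob_many_common_nbr_triples err2])
        (use assms(1,2) k8 \<open>k \<le> n\<close> in auto)
  qed
  finally have bound: "measure_pmf.prob (gnp_edges n p) (?Few \<union> ?Many)
      \<le> p + (9 * real m) ^ m * (real n * p ^ m)" .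
  show ?thesis
  proof (rule prob_random_graph_ge[OF _ bound])
    fix x assume x: "x \<notin> ?Few \<union> ?Many"
    have "m * k < card {e \<in> all_edges {..<k}. x e}"
      using x mk by (simp flip: of_nat_less_iff[where 'a = real])
    moreover have "card {t \<in> common_nbr_triples m n k. \<forall>e\<in>triple_edges t. x e} \<le> k"
      using x by simp
    ultimately show "warmth (graph_of n x) \<le> enat (m + 1)"
      using cold_if_few_common_nbr_triples[of m _ k n x] \<open>1 \<le> m\<close> \<open>k \<le> n\<close>
      by (intro warmth_le_if_cold) auto
  qed
qed

section \<open>Choice of the exponent and passage to the limit\<close>

theorem theorem3p1:
  fixes \<alpha> :: real and p :: "nat \<Rightarrow> real"
  assumes "\<alpha> > 0"
    and "\<And>n. 0 \<le> p n \<and> p n \<le> 1"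
    and "p \<in> O(\<lambda>n. real n powr (- \<alpha>))"
  shows "(\<lambda>n. measure_pmf.prob (random_graph n (p n))
            {G. warmth G \<le> enat (nat \<lfloor>1 / \<alpha> + 2\<rfloor>)}) \<longlonglongrightarrow> 1"
proof -
  \<comment> \<open>The least integer strictly above \<open>1 / \<alpha>\<close>: it makes
    \<open>1 - \<alpha> * m\<close> negative, and \<open>m + 1\<close> is the claimed bound.\<close>
  define m where "m = nat \<lfloor>1 / \<alpha>\<rfloor> + 1"
  have fl: "0 \<le> \<lfloor>1 / \<alpha>\<rfloor>" using assms(1) by simp
  then have m: "1 \<le> m" "nat \<lfloor>1 / \<alpha> + 2\<rfloor> = m + 1"
    by (simp_all add: m_def nat_add_distrib)
  have "1 / \<alpha> < real m"
    unfolding m_def using fl by (simp add: of_nat_nat) linarith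
  then have m\<alpha>: "1 - \<alpha> * real m < 0"
    using assms(1) by (simp add: field_simps)
  obtain C where C: "C > 0" "eventually (\<lambda>n. norm (p n) \<le> C * norm (real n powr (- \<alpha>))) sequentially"
    using assms(3) by (elim landau_o.bigE)
  \<comment> \<open>A common bound for the errors of both ranges: the sparse one with
    \<open>B = 8 * m\<close> contributes \<open>8 * p\<close>, which also covers the single
    \<open>p\<close> of the dense one.\<close>
  define err where "err n = 4 * (exp (2 * (8 * real m)) / real n) + 8 * (C * real n powr (- \<alpha>))
    + (9 * real m) ^ m * (C ^ m * real n powr (1 - \<alpha> * real m))" for n :: nat
  have real_n: "filterlim real at_top sequentially"
    by (rule filterlim_real_sequentially)
  have lim_\<alpha>: "(\<lambda>n. real n powr (- \<alpha>)) \<longlonglongrightarrow> 0"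
    by (rule tendsto_neg_powr) (use assms(1) real_n in auto)
  have lim_m: "(\<lambda>n. real n powr (1 - \<alpha> * real m)) \<longlonglongrightarrow> 0"
    by (rule tendsto_neg_powr) (use m\<alpha> real_n in auto)
  have lim_n: "(\<lambda>n. exp (2 * (8 * real m)) / real n) \<longlonglongrightarrow> 0"
    by (rule lim_const_over_n)
  have "err \<longlonglongrightarrow> 4 * 0 + 8 * (C * 0) + (9 * real m) ^ m * (C ^ m * 0)"
    unfolding err_def by (intro tendsto_intros lim_\<alpha> lim_m lim_n)
  then have "(\<lambda>n. 1 - err n) \<longlonglongrightarrow> 1 - 0"
    by (intro tendsto_intros) simp
  then have lower_lim: "(\<lambda>n. 1 - err n) \<longlonglongrightarrow> 1" by simp
  have small: "eventually (\<lambda>n. C * real n powr (- \<alpha>) < 1 / 2) sequentially"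
    using tendsto_mult_left[OF lim_\<alpha>, of C] by (rule order_tendstoD) simp
  have lower: "eventually (\<lambda>n. 1 - err n \<le> measure_pmf.prob (random_graph n (p n))
      {G. warmth G \<le> enat (m + 1)}) sequentially"
    using C(2) small eventually_ge_at_top[of 1]
  proof eventually_elim
    case (elim n)
    then have n: "n \<ge> 1" by simp
    have p: "0 \<le> p n" "p n \<le> C * real n powr (- \<alpha>)" "p n \<le> 1 / 2"
      using elim assms(2)[of n] by auto
    have nn: "0 \<le> (9 * real m) ^ m * (C ^ m * real n powr (1 - \<alpha> * real m))"
      "0 \<le> 4 * (exp (2 * (8 * real m)) / real n)"
      using C(1) by auto
    show ?case
    \<comment> \<open>The split is made for each \<open>n\<close> separately, since \<open>p\<close>
      may alternate between the ranges.\<close>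
    proof (cases "real n * p n \<le> 8 * real m")
      case True
      have "4 * (exp (2 * (8 * real m)) / real n + 2 * p n) \<le> err n"
        using p nn by (simp add: err_def)
      then show ?thesis
        using warmth_sparse_random_graph[OF p(1) p(3) n True m(1)] by linarith
    next
      case False
      have "p n ^ m \<le> (C * real n powr (- \<alpha>)) ^ m"
        using p by (intro power_mono) auto
      also have "\<dots> = C ^ m * real n powr (- \<alpha> * real m)"
        using n by (simp add: power_mult_distrib powr_powr flip: powr_realpow)
      finally have "real n * p n ^ m \<le> real n * (C ^ m * real n powr (- \<alpha> * real m))"
        by (intro mult_left_mono) auto
      also have "\<dots> = C ^ m * real n powr (1 - \<alpha> * real m)"
        using n by (simp add: powr_diff powr_minus field_simps)
      finally have "(9 * real m) ^ m * (real n * p n ^ m)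
          \<le> (9 * real m) ^ m * (C ^ m * real n powr (1 - \<alpha> * real m))"
        by (intro mult_left_mono) auto
      then have "p n + (9 * real m) ^ m * (real n * p n ^ m) \<le> err n"
        unfolding err_def using p(1,2) nn(2) by linarith
      moreover have "p n > 0"
        using False p(1) by (cases "p n = 0") auto
      ultimately show ?thesis
        using warmth_dense_random_graph[of "p n" m n] p False m(1) by auto
    qed
  qed
  show ?thesis
    unfolding m(2)
    by (rule tendsto_sandwich[OF lower _ lower_lim tendsto_const]) simp
qed

end
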